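(* Let $M_{1}$ and $M_{2}$ be two $R$-modules, $f:M_{1}\rightarrow M_{2}$ an $R$-module homomorphism, and $S$ a multiplicatively closed subset of $R$. Then the following statements hold. (1) If $f$ is an epimorphism and $N$ is a weakly $S$-prime submodule of $M_{1}$ containing $\ker(f)$, then $f(N)$ is a weakly $S$-prime submodule of $M_{2}$. (2) If $f$ is a monomorphism and $K$ is a weakly $S$-prime submodule of $M_{2}$ with $(f^{-1}(K):_{R}M_{1})\cap S=\emptyset$, then $f^{-1}(K)$ is a weakly $S$-prime submodule of $M_{1}$.
   Context: Rings are commutative with non-zero identity and modules are unital. A non-empty subset $S$ of $R$ is multiplicatively closed if it is closed under multiplication. For a submodule $N$ of an $R$-module $M$, $(N:_{R}M)=\{r\in R: rM\subseteq N\}$. A submodule $N$ of $M$ with $(N:_{R}M)\cap S=\emptyset$ is weakly $S$-prime if there exists a fixed $s\in S$ such that for all $a\in R$, $m\in M$ with $0\neq am\in N$, either $sa\in(N:_{R}M)$ or $sm\in N$. *)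

theory Defs
  imports "Jordan_Normal_Form.Missing_VectorSpace"
begin

text \<open>
  Module homomorphisms, their kernels and submodules are those of the theory
  \<open>LinearCombinations\<close> (\<open>mod_hom\<close>, \<open>mod_hom.ker\<close>, \<open>LinearCombinations.submodule\<close>); the last
  one shadows \<open>Module.submodule\<close> and takes its arguments in the order ring, subset, module.
\<close>

text \<open>The unit is not required to lie in \<open>S\<close>, and \<open>S\<close> may contain zero.\<close>

definition mult_closed :: "('r, 'p) ring_scheme \<Rightarrow> 'r set \<Rightarrow> bool" where
  "mult_closed R S \<longleftrightarrow>
     S \<subseteq> carrier R \<and> S \<noteq> {} \<and> (\<forall>s\<in>S. \<forall>t\<in>S. s \<otimes>\<^bsub>R\<^esub> t \<in> S)"

definition residual ::
  "('r, 'p) ring_scheme \<Rightarrow> ('r, 'm, 'q) module_scheme \<Rightarrow> 'm set \<Rightarrow> 'r set" where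
  "residual R M N = {r \<in> carrier R. (\<lambda>m. r \<odot>\<^bsub>M\<^esub> m) ` carrier M \<subseteq> N}"

definition weakly_S_prime ::
  "('r, 'p) ring_scheme \<Rightarrow> 'r set \<Rightarrow> ('r, 'm, 'q) module_scheme \<Rightarrow> 'm set \<Rightarrow> bool" where
  "weakly_S_prime R S M N \<longleftrightarrow>
     LinearCombinations.submodule R N M \<and>
     residual R M N \<inter> S = {} \<and>
     (\<exists>s\<in>S. \<forall>a\<in>carrier R. \<forall>m\<in>carrier M.
        \<zero>\<^bsub>M\<^esub> \<noteq> a \<odot>\<^bsub>M\<^esub> m \<and> a \<odot>\<^bsub>M\<^esub> m \<in> N \<longrightarrow>
          s \<otimes>\<^bsub>R\<^esub> a \<in> residual R M N \<or> s \<odot>\<^bsub>M\<^esub> m \<in> N)"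

end

theory Submission
  imports Defs
begin

text \<open>
  Weak \<open>S\<close>-primeness is a condition on nonzero products \<open>a m\<close> in the submodule, so it passes along
  \<open>f\<close> as soon as membership in the submodules, their residuals, and nonvanishing of products can be
  compared on both sides. The same \<open>s\<close> serves before and after the transfer.

  For the image of a submodule \<open>P\<close> containing the kernel, \<open>f m\<close> lies in \<open>f P\<close> only if \<open>m\<close>
  already lies in \<open>P\<close> (\<open>image_mem_iff\<close>); with surjectivity, \<open>P\<close> and \<open>f P\<close> then have
  the same residual (\<open>residual_image\<close>). A nonzero product \<open>a y\<close> in \<open>f P\<close> lifts to a product
  \<open>a m\<close> in \<open>P\<close>, and this lift is nonzero because its image is.

  For the preimage, membership is comparable by definition and it is nonvanishing that has to be
  carried forward: injectivity is what keeps \<open>f (a m)\<close> nonzero. The residual can grow, from that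
  of \<open>K\<close> to that of the preimage, when \<open>f\<close> is not surjective. This is harmless for the dichotomy
  but is the reason why disjointness from \<open>S\<close> has to be assumed for the preimage.
\<close>

context mod_hom
begin

lemma submodule_image:
  assumes "LinearCombinations.submodule R P M"
  shows "LinearCombinations.submodule R (f ` P) N"
proof -
  interpret P: LinearCombinations.submodule R P M by fact
  have carr: "p \<in> carrier M" if "p \<in> P" for p
    using that P.subset by blast
  show ?thesis
  proof (rule LinearCombinations.submodule.intro)
    show "module R N" by (rule N.module_axioms)
    show "f ` P \<subseteq> carrier N" using carr by auto
    show "v \<oplus>\<^bsub>N\<^esub> w \<in> f ` P" if vw: "v \<in> f ` P" "w \<in> f ` P" for v w
    proof -
      from vw obtain p q where "p \<in> P" "q \<in> P" "v = f p" "w = f q" by blast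
      then have "v \<oplus>\<^bsub>N\<^esub> w = f (p \<oplus>\<^bsub>M\<^esub> q)" "p \<oplus>\<^bsub>M\<^esub> q \<in> P" using carr by auto
      then show ?thesis by blast
    qed
    show "\<zero>\<^bsub>N\<^esub> \<in> f ` P" using f0_is_0 P.zero_closed by (metis imageI)
    show "c \<odot>\<^bsub>N\<^esub> v \<in> f ` P" if c: "c \<in> carrier R" and v: "v \<in> f ` P" for c v
    proof -
      from v obtain p where "p \<in> P" "v = f p" by blast
      then have "c \<odot>\<^bsub>N\<^esub> v = f (c \<odot>\<^bsub>M\<^esub> p)" "c \<odot>\<^bsub>M\<^esub> p \<in> P" using carr c by auto
      then show ?thesis by blast
    qed
  qed
qed

lemma submodule_vimage:
  assumes "LinearCombinations.submodule R K N"
  shows "LinearCombinations.submodule R (f -` K \<inter> carrier M) M"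
proof -
  interpret K: LinearCombinations.submodule R K N by fact
  show ?thesis
    by (rule LinearCombinations.submodule.intro) (auto intro: M.module_axioms)
qed

text \<open>
  If \<open>f m = f p\<close> with \<open>p \<in> P\<close>, then \<open>m\<close> differs from \<open>p\<close> by an element of the kernel, and
  \<open>P\<close> absorbs the kernel.
\<close>

lemma image_mem_iff:
  assumes P: "LinearCombinations.submodule R P M"
    and ker: "ker \<subseteq> P"
    and m: "m \<in> carrier M"
  shows "f m \<in> f ` P \<longleftrightarrow> m \<in> P"
proof
  interpret P: LinearCombinations.submodule R P M by fact
  assume "f m \<in> f ` P"
  then obtain p where p: "p \<in> P" "f m = f p" by blast
  then have pc: "p \<in> carrier M" using P.subset by blast
  have "f (m \<ominus>\<^bsub>M\<^esub> p) = \<zero>\<^bsub>N\<^esub>"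
    using p m pc by (simp add: N.M.r_neg N.M.minus_eq)
  then have "m \<ominus>\<^bsub>M\<^esub> p \<in> P"
    using ker m pc by (auto simp: ker_def)
  then have "(m \<ominus>\<^bsub>M\<^esub> p) \<oplus>\<^bsub>M\<^esub> p \<in> P"
    using p by blast
  then show "m \<in> P"
    using m pc by (simp add: M.M.minus_eq M.M.a_assoc M.M.l_neg)
qed blast

lemma residual_image:
  assumes surj: "f ` carrier M = carrier N"
    and P: "LinearCombinations.submodule R P M"
    and ker: "ker \<subseteq> P"
  shows "residual R N (f ` P) = residual R M P"
proof -
  have "(\<forall>y\<in>carrier N. r \<odot>\<^bsub>N\<^esub> y \<in> f ` P) \<longleftrightarrow> (\<forall>m\<in>carrier M. r \<odot>\<^bsub>M\<^esub> m \<in> P)"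
    if r: "r \<in> carrier R" for r
  proof -
    have "(\<forall>y\<in>carrier N. r \<odot>\<^bsub>N\<^esub> y \<in> f ` P) \<longleftrightarrow> (\<forall>m\<in>carrier M. r \<odot>\<^bsub>N\<^esub> f m \<in> f ` P)"
      unfolding surj[symmetric] by blast
    also have "\<dots> \<longleftrightarrow> (\<forall>m\<in>carrier M. f (r \<odot>\<^bsub>M\<^esub> m) \<in> f ` P)"
      using r by simp
    also have "\<dots> \<longleftrightarrow> (\<forall>m\<in>carrier M. r \<odot>\<^bsub>M\<^esub> m \<in> P)"
      using r image_mem_iff[OF P ker] by (simp del: f_smult)
    finally show ?thesis .
  qed
  then show ?thesis
    unfolding residual_def image_subset_iff by blast
qed

lemma residual_subset_residual_vimage:
  "residual R N K \<subseteq> residual R M (f -` K \<inter> carrier M)"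
  unfolding residual_def by (auto simp: image_subset_iff)

theorem weakly_S_prime_image:
  assumes S: "S \<subseteq> carrier R"
    and surj: "f ` carrier M = carrier N"
    and prime: "weakly_S_prime R S M P"
    and ker: "ker \<subseteq> P"
  shows "weakly_S_prime R S N (f ` P)"
proof -
  from prime have P: "LinearCombinations.submodule R P M"
    and disj: "residual R M P \<inter> S = {}"
    by (auto simp: weakly_S_prime_def)
  from prime obtain s where s: "s \<in> S"
    and dich: "\<And>a m. \<lbrakk>a \<in> carrier R; m \<in> carrier M; \<zero>\<^bsub>M\<^esub> \<noteq> a \<odot>\<^bsub>M\<^esub> m; a \<odot>\<^bsub>M\<^esub> m \<in> P\<rbrakk>
      \<Longrightarrow> s \<otimes>\<^bsub>R\<^esub> a \<in> residual R M P \<or> s \<odot>\<^bsub>M\<^esub> m \<in> P"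
    unfolding weakly_S_prime_def by blast
  have sR: "s \<in> carrier R" using s S by blast
  have "s \<otimes>\<^bsub>R\<^esub> a \<in> residual R N (f ` P) \<or> s \<odot>\<^bsub>N\<^esub> y \<in> f ` P"
    if a: "a \<in> carrier R" and y: "y \<in> carrier N"
      and nz: "\<zero>\<^bsub>N\<^esub> \<noteq> a \<odot>\<^bsub>N\<^esub> y" and mem: "a \<odot>\<^bsub>N\<^esub> y \<in> f ` P" for a y
  proof -
    from y surj obtain m where m: "m \<in> carrier M" "y = f m" by blast
    have ay: "a \<odot>\<^bsub>N\<^esub> y = f (a \<odot>\<^bsub>M\<^esub> m)" using a m by simp
    have "\<zero>\<^bsub>M\<^esub> \<noteq> a \<odot>\<^bsub>M\<^esub> m" using nz ay f0_is_0 by metis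
    moreover have "a \<odot>\<^bsub>M\<^esub> m \<in> P"
      using mem ay image_mem_iff[OF P ker, of "a \<odot>\<^bsub>M\<^esub> m"] a m by (simp del: f_smult)
    ultimately have "s \<otimes>\<^bsub>R\<^esub> a \<in> residual R M P \<or> s \<odot>\<^bsub>M\<^esub> m \<in> P"
      using dich a m by blast
    moreover have "s \<odot>\<^bsub>N\<^esub> y = f (s \<odot>\<^bsub>M\<^esub> m)" using sR m by simp
    ultimately show ?thesis
      using residual_image[OF surj P ker] by auto
  qed
  then show ?thesis
    unfolding weakly_S_prime_def
    using submodule_image[OF P] residual_image[OF surj P ker] disj s by blast
qed

theorem weakly_S_prime_vimage:
  assumes S: "S \<subseteq> carrier R"
    and inj: "inj_on f (carrier M)"
    and prime: "weakly_S_prime R S N K"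
    and disj: "residual R M (f -` K \<inter> carrier M) \<inter> S = {}"
  shows "weakly_S_prime R S M (f -` K \<inter> carrier M)"
proof -
  from prime have K: "LinearCombinations.submodule R K N"
    by (auto simp: weakly_S_prime_def)
  from prime obtain s where s: "s \<in> S"
    and dich: "\<And>a y. \<lbrakk>a \<in> carrier R; y \<in> carrier N; \<zero>\<^bsub>N\<^esub> \<noteq> a \<odot>\<^bsub>N\<^esub> y; a \<odot>\<^bsub>N\<^esub> y \<in> K\<rbrakk>
      \<Longrightarrow> s \<otimes>\<^bsub>R\<^esub> a \<in> residual R N K \<or> s \<odot>\<^bsub>N\<^esub> y \<in> K"
    unfolding weakly_S_prime_def by blast
  have sR: "s \<in> carrier R" using s S by blast
  have "s \<otimes>\<^bsub>R\<^esub> a \<in> residual R M (f -` K \<inter> carrier M) \<or> s \<odot>\<^bsub>M\<^esub> m \<in> f -` K \<inter> carrier M"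
    if a: "a \<in> carrier R" and m: "m \<in> carrier M"
      and nz: "\<zero>\<^bsub>M\<^esub> \<noteq> a \<odot>\<^bsub>M\<^esub> m" and mem: "a \<odot>\<^bsub>M\<^esub> m \<in> f -` K \<inter> carrier M" for a m
  proof -
    have am: "f (a \<odot>\<^bsub>M\<^esub> m) = a \<odot>\<^bsub>N\<^esub> f m" using a m by simp
    have "f \<zero>\<^bsub>M\<^esub> \<noteq> f (a \<odot>\<^bsub>M\<^esub> m)"
      using nz a m by (simp add: inj_on_eq_iff[OF inj] del: f0_is_0 f_smult)
    then have "\<zero>\<^bsub>N\<^esub> \<noteq> a \<odot>\<^bsub>N\<^esub> f m" using am by simp
    moreover have "a \<odot>\<^bsub>N\<^esub> f m \<in> K" using mem am by simp
    ultimately have "s \<otimes>\<^bsub>R\<^esub> a \<in> residual R N K \<or> s \<odot>\<^bsub>N\<^esub> f m \<in> K"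
      using dich a m by blast
    then show ?thesis
      using residual_subset_residual_vimage[of K] sR m by auto
  qed
  then show ?thesis
    unfolding weakly_S_prime_def
    using submodule_vimage[OF K] disj s by blast
qed

end

theorem proposition8:
  fixes R :: "('r, 'p) ring_scheme"
    and M\<^sub>1 :: "('r, 'm, 'q) module_scheme"
    and M\<^sub>2 :: "('r, 'n, 'u) module_scheme"
    and f :: "'m \<Rightarrow> 'n"
    and S :: "'r set"
  assumes "cring R" and "\<one>\<^bsub>R\<^esub> \<noteq> \<zero>\<^bsub>R\<^esub>"
    and "module R M\<^sub>1" and "module R M\<^sub>2"
    and "mod_hom R M\<^sub>1 M\<^sub>2 f"
    and "mult_closed R S"
  shows "(\<forall>N. f ` carrier M\<^sub>1 = carrier M\<^sub>2 \<and> weakly_S_prime R S M\<^sub>1 N \<and>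
              mod_hom.ker M\<^sub>1 M\<^sub>2 f \<subseteq> N \<longrightarrow>
              weakly_S_prime R S M\<^sub>2 (f ` N)) \<and>
         (\<forall>K. inj_on f (carrier M\<^sub>1) \<and> weakly_S_prime R S M\<^sub>2 K \<and>
              residual R M\<^sub>1 (f -` K \<inter> carrier M\<^sub>1) \<inter> S = {} \<longrightarrow>
              weakly_S_prime R S M\<^sub>1 (f -` K \<inter> carrier M\<^sub>1))"
proof -
  interpret mod_hom R M\<^sub>1 M\<^sub>2 f by fact
  have "S \<subseteq> carrier R"
    using \<open>mult_closed R S\<close> by (simp add: mult_closed_def)
  then show ?thesis
    using weakly_S_prime_image weakly_S_prime_vimage by blast
qed

end
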